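(* Let $\mathfrak{B}$ be a complete Boolean contact algebra satisfying (C5) $\forall x\neq\mathsf{0}\,\exists y\neq\mathsf{0}\; y\ll x$ and the generalized interpolation axiom (GIA): for every $Y\subseteq B$ and every $x\in B$, if $x\ll y$ for all $y\in Y$, then there is $z\in B$ with $x\ll z$ and $z\ll y$ for all $y\in Y$. Then $\mathfrak{B}$ has no W-representatives.
   Context: A Boolean contact algebra is a Boolean algebra $\langle B,\cdot,+,-,\mathsf{0},\mathsf{1}\rangle$ with a relation $\mathsf{C}$ satisfying (C0) $\neg(\mathsf{0}\mathrel{\mathsf{C}} x)$; (C1) $x\leq y\wedge x\neq\mathsf{0}\to x\mathrel{\mathsf{C}} y$; (C2) symmetry; (C3) $x\leq y\to\forall z(z\mathrel{\mathsf{C}} x\to z\mathrel{\mathsf{C}} y)$; (C4) $x\mathrel{\mathsf{C}}(y+z)\to x\mathrel{\mathsf{C}} y\vee x\mathrel{\mathsf{C}} z$. $x\ll y$ iff $\neg(x\mathrel{\mathsf{C}} -y)$. $X\trianglelefteq Y$ means: for every $y\in Y$ there is $x\in X$ with $x\leq y$. An abstractive set is $A\subseteq B$ with (r0) $\mathsf{0}\notin A$; (r1) for $u,v\in A$: $u=v$ or $u\ll v$ or $v\ll u$; (A) no non-zero $x\in B$ has $x\leq y$ for all $y\in A$. A W-representative is an abstractive set $A$ such that for every abstractive set $D$, $D\trianglelefteq A$ implies $A\trianglelefteq D$. *)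

theory Defs
  imports Main
begin

text \<open>
  The algebra is a whole type of class \<^class>\<open>boolean_algebra\<close>.  That class admits the
  one-element algebra; non-degeneracy is a separate hypothesis where it is needed.
\<close>

locale boolean_contact_algebra =
  fixes C :: "'a::boolean_algebra \<Rightarrow> 'a \<Rightarrow> bool"
  assumes C0: "\<not> C bot x"
    and C1: "x \<le> y \<Longrightarrow> x \<noteq> bot \<Longrightarrow> C x y"
    and C2: "C x y \<Longrightarrow> C y x"
    and C3: "x \<le> y \<Longrightarrow> C z x \<Longrightarrow> C z y"
    and C4: "C x (sup y z) \<Longrightarrow> C x y \<or> C x z"

definition nontangential :: "('a::boolean_algebra \<Rightarrow> 'a \<Rightarrow> bool) \<Rightarrow> 'a \<Rightarrow> 'a \<Rightarrow> bool" where
  "nontangential C x y \<longleftrightarrow> \<not> C x (- y)"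

definition axiom_C5 :: "('a::boolean_algebra \<Rightarrow> 'a \<Rightarrow> bool) \<Rightarrow> bool" where
  "axiom_C5 C \<longleftrightarrow> (\<forall>x. x \<noteq> bot \<longrightarrow> (\<exists>y. y \<noteq> bot \<and> nontangential C y x))"

definition axiom_GIA :: "('a::boolean_algebra \<Rightarrow> 'a \<Rightarrow> bool) \<Rightarrow> bool" where
  "axiom_GIA C \<longleftrightarrow>
     (\<forall>Y x. (\<forall>y\<in>Y. nontangential C x y) \<longrightarrow>
        (\<exists>z. nontangential C x z \<and> (\<forall>y\<in>Y. nontangential C z y)))"

definition covered :: "'a::order set \<Rightarrow> 'a set \<Rightarrow> bool"  (infix \<open>\<unlhd>\<close> 50) where
  "X \<unlhd> Y \<longleftrightarrow> (\<forall>y\<in>Y. \<exists>x\<in>X. x \<le> y)"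

definition abstractive :: "('a::boolean_algebra \<Rightarrow> 'a \<Rightarrow> bool) \<Rightarrow> 'a set \<Rightarrow> bool" where
  "abstractive C A \<longleftrightarrow>
     bot \<notin> A \<and>
     (\<forall>u\<in>A. \<forall>v\<in>A. u = v \<or> nontangential C u v \<or> nontangential C v u) \<and>
     \<not> (\<exists>x. x \<noteq> bot \<and> (\<forall>y\<in>A. x \<le> y))"

definition W_representative :: "('a::boolean_algebra \<Rightarrow> 'a \<Rightarrow> bool) \<Rightarrow> 'a set \<Rightarrow> bool" where
  "W_representative C A \<longleftrightarrow>
     abstractive C A \<and> (\<forall>D. abstractive C D \<longrightarrow> D \<unlhd> A \<longrightarrow> A \<unlhd> D)"

text \<open>
  A complete Boolean algebra is a type of sort
  \<open>{boolean_algebra, complete_lattice}\<close>.  The library class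
  \<^class>\<open>complete_boolean_algebra\<close> is strictly narrower: it also demands complete
  distributivity, which makes the algebra atomic.
\<close>

end

theory Submission
  imports Defs "HOL-Library.Product_Order"
begin

text \<open>
  By completeness, GIA makes contact completely additive, so suprema of elements \<open>c\<close>
  with \<open>c \<lless> c\<close> (call them clopen) are clopen; interpolation and C5 then show that the
  clopen elements are dense.  An abstractive set \<open>A\<close> is a chain without a minimum, and Zorn's
  lemma yields a clopen \<open>c\<close> such that both \<open>c\<close> and \<open>- c\<close> meet every member of \<open>A\<close>.
  The set of all \<open>a \<sqinter> c\<close> with \<open>a \<in> A\<close> is then abstractive and covers \<open>A\<close>, but is not
  covered by it.
\<close>

text \<open>Disjointness from \<open>x\<close> means lying below \<open>- x\<close>, and a supremum
  lies below \<open>- x\<close> exactly when every member of \<open>S\<close> does.\<close>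

lemma inf_Sup_eq_bot_iff:
  fixes x :: "'a::{boolean_algebra, complete_lattice}"
  shows "inf x (Sup S) = bot \<longleftrightarrow> (\<forall>s\<in>S. inf x s = bot)"
  by (simp add: inf_commute[of x] inf_shunt Sup_le_iff)

section \<open>Contact, nontangential inclusion and abstractive sets\<close>

context boolean_contact_algebra
begin

lemma contact_mono: "C x y \<Longrightarrow> x \<le> x' \<Longrightarrow> y \<le> y' \<Longrightarrow> C x' y'"
  by (meson C2 C3)

lemma nontangential_le:
  assumes "nontangential C x y"
  shows "x \<le> y"
proof (rule ccontr)
  assume "\<not> x \<le> y"
  then have "inf x (- y) \<noteq> bot"
    by (simp add: inf_shunt)
  then have "C (inf x (- y)) (- y)"
    by (intro C1) simp_all
  then have "C x (- y)"
    by (rule contact_mono) simp_all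
  with assms show False
    by (simp add: nontangential_def)
qed

text \<open>By C4, contact with \<open>sup (- v) (- d)\<close> would be contact with
  \<open>- v\<close> or with \<open>- d\<close>; monotonicity of contact excludes both.\<close>

lemma nontangential_inf:
  assumes "nontangential C u v" "nontangential C c d"
  shows "nontangential C (inf u c) (inf v d)"
  using assms unfolding nontangential_def compl_inf
  by (metis C4 contact_mono inf_le1 inf_le2 order_refl)

definition clopen :: "'a \<Rightarrow> bool" where
  "clopen c \<longleftrightarrow> nontangential C c c"

lemma abstractive_linear:
  assumes "abstractive C A" "u \<in> A" "v \<in> A"
  shows "u \<le> v \<or> v \<le> u"
  using assms nontangential_le unfolding abstractive_def by (metis order_refl)

text \<open>A minimum of \<open>A\<close> would be a nonzero lower bound, so some member is not
  above \<open>a\<close>; in a chain it is strictly below.\<close>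

lemma abstractive_less:
  assumes "abstractive C A" "a \<in> A"
  shows "\<exists>b\<in>A. b < a"
proof -
  have "a \<noteq> bot"
    using assms by (auto simp: abstractive_def)
  with assms(1) obtain b where "b \<in> A" "\<not> a \<le> b"
    unfolding abstractive_def by blast
  then show ?thesis
    using abstractive_linear[OF assms] by (metis less_le_not_le)
qed

text \<open>Since \<open>c\<close> is nontangential in itself, meeting both sides with
  \<open>c\<close> preserves nontangential inclusion, and a lower bound of the image is one of
  \<open>A\<close>.\<close>

lemma abstractive_inf_clopen:
  assumes A: "abstractive C A" and c: "clopen c" and meets: "\<And>a. a \<in> A \<Longrightarrow> inf a c \<noteq> bot"
  shows "abstractive C ((\<lambda>a. inf a c) ` A)"
proof -
  have "nontangential C (inf u c) (inf v c)" if "nontangential C u v" for u v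
    using that c nontangential_inf unfolding clopen_def by blast
  then have "\<forall>u\<in>A. \<forall>v\<in>A. inf u c = inf v c \<or>
      nontangential C (inf u c) (inf v c) \<or> nontangential C (inf v c) (inf u c)"
    using A unfolding abstractive_def by metis
  moreover have "\<not> (\<exists>x. x \<noteq> bot \<and> (\<forall>a\<in>A. x \<le> inf a c))"
    using A unfolding abstractive_def by (meson le_inf_iff)
  moreover have "bot \<notin> (\<lambda>a. inf a c) ` A"
    using meets by (metis imageE)
  ultimately show ?thesis
    unfolding abstractive_def by simp
qed

end

section \<open>Complete additivity of contact and density of clopen elements\<close>

locale gia_contact_algebra = boolean_contact_algebra C
  for C :: "'a::{boolean_algebra, complete_lattice} \<Rightarrow> 'a \<Rightarrow> bool" +
  assumes GIA: "axiom_GIA C"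
    and C5: "axiom_C5 C"
begin

text \<open>If \<open>x\<close> touches no member of \<open>S\<close>, GIA for the complements
  yields one \<open>z\<close> around \<open>x\<close> that is disjoint from all of \<open>S\<close>,
  so \<open>Sup S\<close> lies in \<open>- z\<close>, which \<open>x\<close> does not touch.\<close>

lemma contact_Sup:
  assumes "C x (Sup S)"
  shows "\<exists>s\<in>S. C x s"
proof (rule ccontr)
  assume "\<not> ?thesis"
  then have "\<forall>y\<in>uminus ` S. nontangential C x y"
    by (simp add: nontangential_def)
  with GIA obtain z where z: "nontangential C x z" "\<forall>y\<in>uminus ` S. nontangential C z y"
    unfolding axiom_GIA_def by meson
  have "s \<le> - z" if "s \<in> S" for s
    using z(2) that nontangential_le by (metis compl_le_swap1 imageI)
  then have "C x (- z)"
    using assms by (meson C3 Sup_least)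
  with z(1) show False
    by (simp add: nontangential_def)
qed

lemma nontangential_Sup:
  assumes "\<And>s. s \<in> S \<Longrightarrow> nontangential C s x"
  shows "nontangential C (Sup S) x"
  using assms contact_Sup C2 unfolding nontangential_def by blast

lemma nontangential_trans_le: "nontangential C x y \<Longrightarrow> y \<le> z \<Longrightarrow> nontangential C x z"
  unfolding nontangential_def by (meson C3 compl_mono)

lemma clopen_Sup: "(\<And>c. c \<in> S \<Longrightarrow> clopen c) \<Longrightarrow> clopen (Sup S)"
  unfolding clopen_def by (meson nontangential_Sup nontangential_trans_le Sup_upper)

lemma clopen_sup: "clopen c \<Longrightarrow> clopen d \<Longrightarrow> clopen (sup c d)"
  using clopen_Sup[of "{c, d}"] by auto

text \<open>The witness is the supremum of everything nontangential in \<open>x\<close>. GIA for the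
  singleton \<open>{x}\<close> is interpolation: it places each member of \<open>S\<close>
  nontangentially in some member of \<open>S\<close>, hence in \<open>Sup S\<close>. C5 makes
  \<open>Sup S\<close> nonzero.\<close>

lemma clopen_dense:
  assumes "x \<noteq> bot"
  shows "\<exists>c. clopen c \<and> c \<noteq> bot \<and> c \<le> x"
proof -
  define S where "S = {z. nontangential C z x}"
  have "nontangential C z (Sup S)" if "z \<in> S" for z
  proof -
    have "\<forall>y\<in>{x}. nontangential C z y"
      using that by (simp add: S_def)
    with GIA obtain w where "nontangential C z w" "nontangential C w x"
      unfolding axiom_GIA_def by blast
    then show ?thesis
      by (metis S_def Sup_upper mem_Collect_eq nontangential_trans_le)
  qed
  then have "clopen (Sup S)"
    unfolding clopen_def by (rule nontangential_Sup)
  moreover have "Sup S \<le> x"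
    unfolding S_def by (intro Sup_least) (blast intro: nontangential_le)
  moreover obtain y where "y \<noteq> bot" "y \<in> S"
    using C5 assms unfolding axiom_C5_def S_def by blast
  then have "Sup S \<noteq> bot"
    by (metis Sup_upper bot.extremum_uniqueI)
  ultimately show ?thesis
    by blast
qed

section \<open>Splitting an abstractive set by a maximal balanced pair\<close>

text \<open>An equivalence, rather than a demand that members meet both components, survives suprema
  of chains and holds for \<open>(bot, bot)\<close>; maximality will rule out members meeting
  neither.\<close>

definition balanced :: "'a set \<Rightarrow> 'a \<times> 'a \<Rightarrow> bool" where
  "balanced A p \<longleftrightarrow> clopen (fst p) \<and> clopen (snd p) \<and> inf (fst p) (snd p) = bot \<and>
     (\<forall>a\<in>A. inf a (fst p) = bot \<longleftrightarrow> inf a (snd p) = bot)"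

text \<open>Linearity keeps the components disjoint: \<open>fst p\<close> and \<open>snd q\<close>
  both lie inside the larger of the two pairs. Empty \<open>P\<close> is allowed, which covers the
  empty chain in Zorn's lemma.\<close>

lemma balanced_Sup:
  assumes "\<And>p. p \<in> P \<Longrightarrow> balanced A p"
    and linear: "\<And>p q. p \<in> P \<Longrightarrow> q \<in> P \<Longrightarrow> p \<le> q \<or> q \<le> p"
  shows "balanced A (Sup P)"
proof -
  have "inf (fst p) (snd q) = bot" if "p \<in> P" "q \<in> P" for p q
  proof -
    have "inf (fst p) (snd q) \<le> inf (fst p) (snd p) \<or> inf (fst p) (snd q) \<le> inf (fst q) (snd q)"
      using linear[OF that] by (metis inf_mono less_eq_prod_def order_refl)
    then show ?thesis
      using assms(1) that by (metis balanced_def bot.extremum_uniqueI)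
  qed
  then have "inf (Sup (fst ` P)) (snd q) = bot" if "q \<in> P" for q
    using that by (subst inf_commute) (simp add: inf_Sup_eq_bot_iff inf_commute)
  then have "inf (fst (Sup P)) (snd (Sup P)) = bot"
    by (simp add: fst_Sup snd_Sup inf_Sup_eq_bot_iff)
  moreover have "clopen (fst (Sup P))" "clopen (snd (Sup P))"
    unfolding fst_Sup snd_Sup using assms(1) by (auto simp: balanced_def intro!: clopen_Sup)
  moreover have "inf a (fst (Sup P)) = bot \<longleftrightarrow> inf a (snd (Sup P)) = bot" if "a \<in> A" for a
    using assms(1) that by (simp add: fst_Sup snd_Sup inf_Sup_eq_bot_iff balanced_def)
  ultimately show ?thesis
    by (simp add: balanced_def)
qed

text \<open>
  Along a descending sequence in \<open>A\<close>, nonzero clopen pieces of the successive differences are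
  added alternately to the two components.
\<close>

lemma balanced_extend:
  assumes A: "abstractive C A" and bal: "balanced A (c, d)"
    and a: "a \<in> A" "inf a c = bot"
  shows "\<exists>p. balanced A p \<and> (c, d) < p"
proof -
  have d: "inf a d = bot"
    using a bal by (simp add: balanced_def)
  \<comment> \<open>The descent never stops because \<open>A\<close> has no minimum; starting at
    \<open>a\<close> keeps all later pieces below \<open>a\<close>, hence disjoint from
    \<open>c\<close> and \<open>d\<close>.\<close>
  have "\<exists>f::nat \<Rightarrow> 'a. f 0 = a \<and> (\<forall>n. f n \<in> A \<and> f (Suc n) < f n)"
    using dependent_nat_choice[of "\<lambda>n x. x \<in> A \<and> (n = 0 \<longrightarrow> x = a)" "\<lambda>n x y. y < x"]
      a abstractive_less[OF A] by (metis nat.distinct(1))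
  then obtain f :: "nat \<Rightarrow> 'a" where f0: "f 0 = a" and fA: "f n \<in> A" and fS: "f (Suc n) < f n" for n
    by blast
  have f_anti: "f n \<le> f m" if "m \<le> n" for m n
    by (rule lift_Suc_antimono_le[of f]) (simp_all add: fS less_imp_le that)
  have "inf (f n) (- f (Suc n)) \<noteq> bot" for n
    using fS[of n] by (auto simp: inf_shunt)
  then have "\<exists>p. clopen p \<and> p \<noteq> bot \<and> p \<le> inf (f n) (- f (Suc n))" for n
    using clopen_dense by blast
  then obtain p where p: "clopen (p n)" "p n \<noteq> bot" "p n \<le> f n" "p n \<le> - f (Suc n)" for n
    by (metis le_inf_iff)
  have less_disj: "inf (p m) (p n) = bot" if "m < n" for m n
  proof -
    have "p n \<le> f (Suc m)"
      using p(3) f_anti that by (meson Suc_leI order_trans)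
    then show ?thesis
      using p(4)[of m] by (metis compl_le_compl_iff inf_shunt order_trans)
  qed
  then have p_disj: "inf (p m) (p n) = bot" if "m \<noteq> n" for m n
    using that by (metis inf_commute nat_neq_iff)
  have p_out: "inf c (p n) = bot" "inf d (p n) = bot" for n
  proof -
    have "p n \<le> a"
      using p(3) f_anti[of 0 n] f0 by (metis le0 order_trans)
    then show "inf c (p n) = bot" "inf d (p n) = bot"
      using a(2) d by (metis inf_commute inf_shunt order_trans)+
  qed
  \<comment> \<open>A member of \<open>A\<close> meeting one piece is not below
    \<open>f (Suc n)\<close>, so it contains \<open>f (Suc n)\<close> and with it the next piece.
    Hence even and odd pieces are met by the same members.\<close>
  have meets_Suc: "inf b (p (Suc n)) \<noteq> bot" if "b \<in> A" "inf b (p n) \<noteq> bot" for b n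
  proof -
    have "\<not> b \<le> f (Suc n)"
      using that(2) p(4)[of n] by (metis compl_le_swap1 inf_shunt order_trans)
    then have "p (Suc n) \<le> b"
      using abstractive_linear[OF A that(1) fA] p(3) order_trans by blast
    then show ?thesis
      using p(2) by (simp add: inf_absorb2)
  qed
  define x where "x = Sup (range (\<lambda>n. p (2 * n)))"
  define y where "y = Sup (range (\<lambda>n. p (Suc (2 * n))))"
  have x_bot: "inf b x = bot \<longleftrightarrow> (\<forall>n. inf b (p (2 * n)) = bot)" for b
    by (simp add: x_def inf_Sup_eq_bot_iff)
  have y_bot: "inf b y = bot \<longleftrightarrow> (\<forall>n. inf b (p (Suc (2 * n))) = bot)" for b
    by (simp add: y_def inf_Sup_eq_bot_iff)
  have "2 * n \<noteq> Suc (2 * m)" for m n :: nat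
    by presburger
  then have "inf (p (2 * n)) y = bot" for n
    by (simp add: y_bot p_disj)
  then have "inf x y = bot"
    by (metis inf_commute x_bot)
  moreover have "inf x d = bot" "inf c y = bot"
    using p_out by (simp_all add: inf_commute[of x] x_bot y_bot)
  moreover have "inf c d = bot"
    using bal by (simp add: balanced_def)
  ultimately have "inf (sup c x) (sup d y) = bot"
    by (simp add: inf_sup_distrib1 inf_sup_distrib2)
  moreover have "clopen (sup c x)" "clopen (sup d y)"
    using bal p(1) unfolding x_def y_def balanced_def
    by (auto intro!: clopen_sup clopen_Sup)
  moreover have "inf b x = bot \<longleftrightarrow> inf b y = bot" if "b \<in> A" for b
  proof
    assume "inf b x = bot"
    \<comment> \<open>The successor of an odd index is the even index \<open>2 * Suc n\<close>, so
      that piece lies in \<open>x\<close>.\<close>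
    then have "inf b (p (Suc (Suc (2 * n)))) = bot" for n
      unfolding x_bot by (metis add_2_eq_Suc mult_Suc_right)
    then show "inf b y = bot"
      using meets_Suc[OF that] y_bot by blast
  next
    assume "inf b y = bot"
    then show "inf b x = bot"
      using meets_Suc[OF that] x_bot y_bot by blast
  qed
  then have "inf b (sup c x) = bot \<longleftrightarrow> inf b (sup d y) = bot" if "b \<in> A" for b
    using bal that by (simp add: balanced_def inf_sup_distrib1)
  ultimately have "balanced A (sup c x, sup d y)"
    by (simp add: balanced_def)
  moreover have "\<not> sup c x \<le> c"
  proof
    assume "sup c x \<le> c"
    moreover have "p (2 * 0) \<le> x"
      unfolding x_def by (rule Sup_upper) blast
    ultimately have "p (2 * 0) \<le> c"
      by (meson le_sup_iff order_trans)
    then show False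
      using p_out(1)[of "2 * 0"] p(2)[of "2 * 0"] by (simp add: inf_absorb2)
  qed
  then have "(c, d) < (sup c x, sup d y)"
    by (simp add: less_le_not_le)
  ultimately show ?thesis
    by blast
qed

text \<open>In a maximal balanced pair \<open>(c, d)\<close> every member of \<open>A\<close> meets
  \<open>c\<close>, as otherwise the pair extends; by balance it also meets \<open>d\<close>, which
  is disjoint from \<open>c\<close>, so it is not below \<open>c\<close>.\<close>

lemma clopen_splitting:
  assumes A: "abstractive C A"
  shows "\<exists>c. clopen c \<and> (\<forall>a\<in>A. inf a c \<noteq> bot \<and> \<not> a \<le> c)"
proof -
  let ?S = "Collect (balanced A)"
  have "\<exists>m\<in>?S. \<forall>p\<in>?S. m \<le> p \<longrightarrow> p = m"
  proof (rule predicate_Zorn)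
    show "partial_order_on ?S (relation_of (\<le>) ?S)"
      by (rule partial_order_on_relation_ofI) auto
    fix P assume "P \<in> Chains (relation_of (\<le>) ?S)"
    then have "balanced A (Sup P)"
      by (intro balanced_Sup) (auto simp: Chains_def relation_of_def)
    then show "\<exists>u\<in>?S. \<forall>p\<in>P. p \<le> u"
      by (blast intro: Sup_upper)
  qed
  then obtain c d where bal: "balanced A (c, d)"
    and "\<And>p. balanced A p \<Longrightarrow> (c, d) \<le> p \<Longrightarrow> p = (c, d)"
    by auto
  then have meets: "inf a c \<noteq> bot" if "a \<in> A" for a
    using balanced_extend[OF A bal that] by (metis less_le)
  moreover have "\<not> a \<le> c" if "a \<in> A" for a
  proof
    assume "a \<le> c"
    then have "inf a d = bot"
      using bal unfolding balanced_def by (metis fst_conv snd_conv inf_shunt order_trans)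
    then show False
      using bal meets that by (simp add: balanced_def)
  qed
  ultimately show ?thesis
    using bal unfolding balanced_def by auto
qed

end

theorem theorem6p1:
  fixes C :: "'a::{boolean_algebra, complete_lattice} \<Rightarrow> 'a \<Rightarrow> bool"
  assumes nondegenerate: "(bot::'a) \<noteq> top"
    and bca: "boolean_contact_algebra C"
    and C5: "axiom_C5 C"
    and GIA: "axiom_GIA C"
  shows "\<not> (\<exists>A. W_representative C A)"
proof
  interpret gia_contact_algebra C
    using bca GIA C5 by (simp add: gia_contact_algebra_def gia_contact_algebra_axioms_def)
  assume "\<exists>A. W_representative C A"
  then obtain A where A: "abstractive C A"
    and minimal: "\<And>D. abstractive C D \<Longrightarrow> D \<unlhd> A \<Longrightarrow> A \<unlhd> D"
    unfolding W_representative_def by blast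
  obtain c where c: "clopen c" "\<And>a. a \<in> A \<Longrightarrow> inf a c \<noteq> bot" "\<And>a. a \<in> A \<Longrightarrow> \<not> a \<le> c"
    using clopen_splitting[OF A] by blast
  have "(\<lambda>a. inf a c) ` A \<unlhd> A"
    unfolding covered_def by (blast intro: inf_le1)
  then have "A \<unlhd> (\<lambda>a. inf a c) ` A"
    using abstractive_inf_clopen[OF A c(1,2)] minimal by blast
  \<comment> \<open>Were \<open>A\<close> empty, \<open>top\<close> would be a nonzero lower bound.
    For this \<open>a\<close>, the covering gives a member of \<open>A\<close> below
    \<open>inf a c\<close>, hence below \<open>c\<close>.\<close>
  moreover obtain a where "a \<in> A"
    using A nondegenerate unfolding abstractive_def by metis
  ultimately show False
    using c(3) unfolding covered_def by (metis imageI le_inf_iff)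
qed

end
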